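(* For $n\ge 1$ let $L_n$ be the normalized Laguerre polynomial of degree $n$, and let $\mu_n$ be the probability measure on $(0,\infty)$ given by $$\mu_n(dx):=|L_n(nx)|^2\,n e^{-nx}\,dx\qquad(x>0).$$ Then, as $n\to\infty$, $\mu_n$ converges weakly to the probability measure $$\frac{1}{\pi}\frac{dx}{\sqrt{4-(x-2)^2}}\qquad(0<x<4).$$
   Context: The normalized Laguerre polynomials $L_n$ are the usual Laguerre polynomials, i.e. the orthonormal polynomials with $\deg L_n=n$ with respect to the exponential distribution $e^{-x}dx$ on $(0,\infty)$: $\int_0^\infty L_n(x)L_m(x)e^{-x}\,dx=\delta_{n,m}$. *)

theory Defs
  imports "HOL-Probability.Probability" "HOL-Computational_Algebra.Polynomial"
begin

text \<open>
  The orthonormal polynomials of the exponential distribution. The two conditions determine each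
  \<^term>\<open>L n\<close> up to sign, and only \<^term>\<open>\<bar>poly (L n) x\<bar>\<^sup>2\<close> is used below, so the sign convention
  is left open.
\<close>

definition normalized_laguerre :: "(nat \<Rightarrow> real poly) \<Rightarrow> bool" where
  "normalized_laguerre L \<longleftrightarrow>
     (\<forall>n. degree (L n) = n) \<and>
     (\<forall>n m. (LBINT x:{0<..}. poly (L n) x * poly (L m) x * exp (- x)) = (if n = m then 1 else 0))"

text \<open>
  Measures on \<open>(0, \<infinity>)\<close> and \<open>(0, 4)\<close> are regarded as Borel measures on the real line supported there.
\<close>

definition laguerre_measure :: "(nat \<Rightarrow> real poly) \<Rightarrow> nat \<Rightarrow> real measure" where
  "laguerre_measure L n =
     density lborel (\<lambda>x. ennreal (indicator {0<..} x *
       (\<bar>poly (L n) (real n * x)\<bar>\<^sup>2 * (real n * exp (- (real n * x))))))"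

definition arcsine_measure :: "real measure" where
  "arcsine_measure =
     density lborel (\<lambda>x. ennreal (indicator {0<..<4} x * (1 / pi * (1 / sqrt (4 - (x - 2)\<^sup>2)))))"

text \<open>
  Such a family exists: the classical Laguerre polynomials satisfy the two conditions.
\<close>

definition laguerre :: "nat \<Rightarrow> real poly" where
  "laguerre n = (\<Sum>k\<le>n. monom ((- 1) ^ k * real (n choose k) / fact k) k)"

lemma coeff_laguerre:
  "coeff (laguerre n) k = (if k \<le> n then (- 1) ^ k * real (n choose k) / fact k else 0)"
  by (simp add: laguerre_def coeff_sum)

lemma degree_laguerre: "degree (laguerre n) = n"
  by (intro antisym degree_le le_degree) (auto simp: coeff_laguerre)

lemma poly_laguerre: "poly (laguerre n) x = (\<Sum>k\<le>n. (- 1) ^ k * real (n choose k) / fact k * x ^ k)"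
  by (simp add: laguerre_def poly_sum poly_monom)

lemma has_bochner_integral_power_exp:
  "has_bochner_integral lborel (\<lambda>x. indicator {0<..} x *\<^sub>R (x ^ k * exp (- x))) (fact k :: real)"
proof (rule has_bochner_integral_nn_integral)
  have "(\<integral>\<^sup>+ x. ennreal (indicator {0<..} x *\<^sub>R (x ^ k * exp (- x))) \<partial>lborel)
      = (\<integral>\<^sup>+ x. ennreal (x ^ k * exp (- x)) * indicator {0..} x \<partial>lborel)"
    by (intro nn_integral_cong_AE AE_I[where N = "{0}"]) (auto simp: indicator_def)
  then show "(\<integral>\<^sup>+ x. ennreal (indicator {0<..} x *\<^sub>R (x ^ k * exp (- x))) \<partial>lborel) = ennreal (fact k)"
    by (simp add: nn_intergal_power_times_exp_Ici)
qed (auto simp: indicator_def)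

lemma alternating_choose_sum:
  "(\<Sum>k\<le>n. (- 1) ^ k * real (n choose k) * real ((k + a) choose m))
     = (if n \<le> m then (- 1) ^ n * real (a choose (m - n)) else 0)"
proof (induction n arbitrary: a)
  case (Suc n)
  let ?S = "\<lambda>n a. \<Sum>k\<le>n. (- 1) ^ k * real (n choose k) * real ((k + a) choose m)"
  have "?S (Suc n) a = ?S n a - ?S n (Suc a)"
  proof -
    have "?S (Suc n) a = real (a choose m)
        + (\<Sum>k\<le>n. (- 1) ^ Suc k * real (Suc n choose Suc k) * real ((Suc k + a) choose m))"
      by (subst sum.atMost_Suc_shift) simp
    also have "(\<Sum>k\<le>n. (- 1) ^ Suc k * real (Suc n choose Suc k) * real ((Suc k + a) choose m))
        = (\<Sum>k\<le>n. (- 1) ^ Suc k * real (n choose Suc k) * real ((Suc k + a) choose m)) - ?S n (Suc a)"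
      unfolding sum_subtractf [symmetric] by (intro sum.cong) (simp_all add: algebra_simps)
    also have "real (a choose m)
        + ((\<Sum>k\<le>n. (- 1) ^ Suc k * real (n choose Suc k) * real ((Suc k + a) choose m)) - ?S n (Suc a))
        = (\<Sum>k\<le>Suc n. (- 1) ^ k * real (n choose k) * real ((k + a) choose m)) - ?S n (Suc a)"
      by (subst sum.atMost_Suc_shift) simp
    finally show ?thesis by simp
  qed
  also have "\<dots> = (if Suc n \<le> m then (- 1) ^ Suc n * real (a choose (m - Suc n)) else 0)"
  proof (cases "Suc n \<le> m")
    case True
    then have "m - n = Suc (m - Suc n)" by simp
    then show ?thesis
      unfolding Suc.IH using True by (simp add: algebra_simps)
  next
    case False
    then show ?thesis
      unfolding Suc.IH by (cases "n = m") simp_all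
  qed
  finally show ?case .
qed simp

lemma laguerre_orthonormal:
  "(LBINT x:{0<..}. poly (laguerre n) x * poly (laguerre m) x * exp (- x)) = (if n = m then 1 else 0)"
proof (induction m n rule: linorder_wlog)
  case (le m n)
  define c where "c = (\<lambda>n k. (- 1) ^ k * real (n choose k) / fact k :: real)"
  have "has_bochner_integral lborel
      (\<lambda>x. \<Sum>j\<le>m. \<Sum>k\<le>n. c m j * c n k * (indicator {0<..} x *\<^sub>R (x ^ (k + j) * exp (- x))))
      (\<Sum>j\<le>m. \<Sum>k\<le>n. c m j * c n k * fact (k + j))"
    by (intro has_bochner_integral_sum has_bochner_integral_mult_right has_bochner_integral_power_exp)
  also have "(\<lambda>x. \<Sum>j\<le>m. \<Sum>k\<le>n. c m j * c n k * (indicator {0<..} x *\<^sub>R (x ^ (k + j) * exp (- x))))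
      = (\<lambda>x. indicator {0<..} x *\<^sub>R (poly (laguerre n) x * poly (laguerre m) x * exp (- x)))"
  proof
    fix x :: real
    have "poly (laguerre n) x * poly (laguerre m) x = (\<Sum>j\<le>m. \<Sum>k\<le>n. (c m j * x ^ j) * (c n k * x ^ k))"
      unfolding sum_product [symmetric] by (simp add: poly_laguerre c_def)
    then show "(\<Sum>j\<le>m. \<Sum>k\<le>n. c m j * c n k * (indicator {0<..} x *\<^sub>R (x ^ (k + j) * exp (- x))))
        = indicator {0<..} x *\<^sub>R (poly (laguerre n) x * poly (laguerre m) x * exp (- x))"
      by (simp add: sum_distrib_left sum_distrib_right power_add mult_ac)
  qed
  finally have "(LBINT x:{0<..}. poly (laguerre n) x * poly (laguerre m) x * exp (- x))
      = (\<Sum>j\<le>m. \<Sum>k\<le>n. c m j * c n k * fact (k + j))"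
    by (simp add: set_lebesgue_integral_def has_bochner_integral_integral_eq)
  also have "\<dots> = (\<Sum>j\<le>m. c m j * fact j * (\<Sum>k\<le>n. (- 1) ^ k * real (n choose k) * real ((k + j) choose j)))"
    by (simp add: sum_distrib_left c_def binomial_fact field_simps)
  also have "\<dots> = (\<Sum>j\<le>m. if j = n then c m j * fact j * (- 1) ^ n else 0)"
    using le by (intro sum.cong) (auto simp: alternating_choose_sum)
  also have "\<dots> = (if n = m then 1 else 0)"
    using le by (simp add: c_def flip: power_mult_distrib)
  finally show ?case .
next
  case (sym m n)
  then show ?case by (simp add: mult_ac eq_commute)
qed

lemma normalized_laguerre_laguerre: "normalized_laguerre laguerre"
  by (simp add: normalized_laguerre_def degree_laguerre laguerre_orthonormal)

end

theory Submission
  imports Defs "HOL-Real_Asymp.Real_Asymp"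
begin

text \<open>
  Orthonormality determines \<open>L n\<close> up to sign, so the classical Laguerre polynomials may be used. By
  their three-term recurrence, multiplication by \<open>x / n\<close> acts near index \<open>n\<close> asymptotically like the
  Toeplitz operator with symbol \<open>2 - 2 cos t\<close>. Hence the moments of \<open>\<mu>\<^sub>n\<close> converge to the means of
  \<open>(2 - 2 cos t)\<^sup>p\<close> over \<open>(0, \<pi>)\<close>, which the substitution \<open>x = 2 - 2 cos t\<close> identifies with the
  moments of the arcsine law on \<open>(0, 4)\<close>. As that law has bounded support, convergence of moments
  gives convergence of characteristic functions, and Levy's continuity theorem applies.
\<close>

section \<open>The Laguerre functional\<close>

text \<open>Taking polynomials as arguments makes the integral a linear functional, so that
  orthogonality and the recurrence become polynomial algebra.\<close>

definition laguerre_functional :: "real poly \<Rightarrow> real" where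
  "laguerre_functional p = (LBINT x:{0<..}. poly p x * exp (- x))"

lemma has_bochner_integral_poly_exp:
  "has_bochner_integral lborel (\<lambda>x. indicator {0<..} x *\<^sub>R (poly p x * exp (- x))) (laguerre_functional p)"
proof -
  have "integrable lborel
      (\<lambda>x. \<Sum>k\<le>degree p. coeff p k * (indicator {0<..} x *\<^sub>R (x ^ k * exp (- x))))"
    by (intro Bochner_Integration.integrable_sum integrable_mult_right
        integrable.intros [OF has_bochner_integral_power_exp])
  also have "(\<lambda>x. \<Sum>k\<le>degree p. coeff p k * (indicator {0<..} x *\<^sub>R (x ^ k * exp (- x))))
      = (\<lambda>x. indicator {0<..} x *\<^sub>R (poly p x * exp (- x)))"
    by (simp add: poly_altdef sum_distrib_left sum_distrib_right mult_ac)
  finally show ?thesis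
    unfolding laguerre_functional_def set_lebesgue_integral_def by (rule has_bochner_integral_integrable)
qed

lemma laguerre_functional_add: "laguerre_functional (p + q) = laguerre_functional p + laguerre_functional q"
proof (rule has_bochner_integral_eq [OF has_bochner_integral_poly_exp])
  show "has_bochner_integral lborel (\<lambda>x. indicator {0<..} x *\<^sub>R (poly (p + q) x * exp (- x)))
      (laguerre_functional p + laguerre_functional q)"
    using has_bochner_integral_add [OF has_bochner_integral_poly_exp [of p] has_bochner_integral_poly_exp [of q]]
    by (simp add: algebra_simps)
qed

lemma laguerre_functional_smult: "laguerre_functional (smult c p) = c * laguerre_functional p"
proof (rule has_bochner_integral_eq [OF has_bochner_integral_poly_exp])
  show "has_bochner_integral lborel (\<lambda>x. indicator {0<..} x *\<^sub>R (poly (smult c p) x * exp (- x)))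
      (c * laguerre_functional p)"
    using has_bochner_integral_mult_right [OF has_bochner_integral_poly_exp [of p], of c]
    by (simp add: algebra_simps)
qed

lemma laguerre_functional_diff: "laguerre_functional (p - q) = laguerre_functional p - laguerre_functional q"
  using laguerre_functional_add [of "p - q" q] by simp

section \<open>Orthogonality, uniqueness up to sign and the three-term recurrence\<close>

lemma normalized_laguerre_degree: "normalized_laguerre L \<Longrightarrow> degree (L n) = n"
  by (simp add: normalized_laguerre_def)

lemma normalized_laguerre_orthonormal:
  "normalized_laguerre L \<Longrightarrow> laguerre_functional (L n * L m) = (if n = m then 1 else 0)"
  by (simp add: normalized_laguerre_def laguerre_functional_def)

lemma normalized_laguerre_nonzero: "normalized_laguerre L \<Longrightarrow> L n \<noteq> 0"
  \<comment> \<open>The instance \<open>[of 0 0]\<close> gives the value 0 at the zero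
    polynomial.\<close>
  using normalized_laguerre_orthonormal [of L n n] laguerre_functional_smult [of 0 0] by auto

text \<open>Cancelling the leading term is one step of an expansion in a family with one polynomial
  of each degree. The case \<open>r = 0\<close> stands apart because the zero polynomial also has
  degree 0.\<close>

lemma degree_reduce:
  assumes "degree p = degree q" "q \<noteq> (0 :: real poly)"
  obtains r where "p = smult (lead_coeff p / lead_coeff q) q + r" "r = 0 \<or> degree r < degree p"
proof
  define r where "r = p - smult (lead_coeff p / lead_coeff q) q"
  show "p = smult (lead_coeff p / lead_coeff q) q + r"
    by (simp add: r_def)
  have "degree r \<le> degree p"
    unfolding r_def using assms by (intro degree_diff_le) auto
  moreover have "coeff r (degree p) = 0"
    using assms by (simp add: r_def)
  ultimately show "r = 0 \<or> degree r < degree p"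
    by (metis leading_coeff_0_iff le_neq_implies_less)
qed

text \<open>Strong induction on the degree of \<open>q\<close>: a multiple of
  \<open>L (degree q)\<close> is orthogonal to \<open>L n\<close>, and the remainder has smaller
  degree or is 0.\<close>

lemma normalized_laguerre_orthogonal:
  assumes L: "normalized_laguerre L" and "degree q < n"
  shows "laguerre_functional (q * L n) = 0"
  using assms(2)
proof (induction "degree q" arbitrary: q rule: less_induct)
  case less
  obtain c r where q: "q = smult c (L (degree q)) + r" and r: "r = 0 \<or> degree r < degree q"
    using degree_reduce [of q "L (degree q)"] L
    by (metis normalized_laguerre_degree normalized_laguerre_nonzero)
  have "laguerre_functional (r * L n) = 0"
    using r less laguerre_functional_smult [of 0 0] by auto
  moreover have "q * L n = smult c (L (degree q) * L n) + r * L n"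
    by (subst q) (simp add: algebra_simps)
  ultimately show ?case
    using less.prems by (simp add: laguerre_functional_add laguerre_functional_smult
        normalized_laguerre_orthonormal [OF L])
qed

text \<open>Orthogonality to all lower degrees forces \<open>L n\<close> to be a multiple of
  \<open>K n\<close>, and normalization makes the factor a sign. Squaring removes that sign.\<close>

lemma normalized_laguerre_square_unique:
  assumes L: "normalized_laguerre L" and K: "normalized_laguerre K"
  shows "L n * L n = K n * K n"
proof -
  obtain c r where Ln: "L n = smult c (K n) + r" and r: "r = 0 \<or> degree r < n"
    using degree_reduce [of "L n" "K n"] L K
    by (metis normalized_laguerre_degree normalized_laguerre_nonzero)
  have "r = 0"
  proof (rule ccontr)
    assume "r \<noteq> 0"
    with r have "degree r < n" by simp
    define d where "d = lead_coeff r / lead_coeff (K (degree r))"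
    obtain s where r_eq: "r = smult d (K (degree r)) + s"
        and s: "s = 0 \<or> degree s < degree r"
      using degree_reduce [of r "K (degree r)"] K unfolding d_def
      by (metis normalized_laguerre_degree normalized_laguerre_nonzero)
    have "d \<noteq> 0"
      using \<open>r \<noteq> 0\<close> normalized_laguerre_nonzero [OF K] by (simp add: d_def)
    \<comment> \<open>Pairing \<open>r\<close> with \<open>K (degree r)\<close> is evaluated twice:
      through its leading term, giving \<open>d\<close>, and through \<open>r = L n - c K n\<close>,
      giving 0.\<close>
    have "r * K (degree r) = (smult d (K (degree r)) + s) * K (degree r)"
      using r_eq by simp
    also have "\<dots> = smult d (K (degree r) * K (degree r)) + s * K (degree r)"
      by (simp add: distrib_right)
    finally have "r * K (degree r) = smult d (K (degree r) * K (degree r)) + s * K (degree r)" .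
    moreover have "laguerre_functional (s * K (degree r)) = 0"
      using s normalized_laguerre_orthogonal [OF K] laguerre_functional_smult [of 0 0] by auto
    ultimately have d: "laguerre_functional (r * K (degree r)) = d"
      by (simp add: laguerre_functional_add laguerre_functional_smult
        normalized_laguerre_orthonormal [OF K])
    have "r * K (degree r) = K (degree r) * L n - smult c (K (degree r) * K n)"
      by (simp add: Ln algebra_simps)
    then have "laguerre_functional (r * K (degree r)) = 0"
      using \<open>degree r < n\<close> normalized_laguerre_orthogonal [OF L, of "K (degree r)" n]
      by (simp add: laguerre_functional_diff laguerre_functional_smult
        normalized_laguerre_orthonormal [OF K] normalized_laguerre_degree [OF K])
    with d \<open>d \<noteq> 0\<close> show False by simp
  qed
  have "L n * L n = smult (c * c) (K n * K n)"
    using Ln \<open>r = 0\<close> by (simp add: algebra_simps)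
  moreover from this have "c * c = 1"
    using normalized_laguerre_orthonormal [OF L, of n n] normalized_laguerre_orthonormal [OF K, of n n]
    by (simp add: laguerre_functional_smult)
  ultimately show ?thesis by simp
qed

text \<open>Comparison of coefficients by Pascal's rule and binomial absorption. For
  \<open>n = 0\<close> the truncated index \<open>n - 1\<close> is harmless, as its factor is
  0.\<close>

lemma laguerre_recurrence:
  "[:0, 1:] * laguerre n = smult (2 * real n + 1) (laguerre n)
     - smult (real n + 1) (laguerre (Suc n)) - smult (real n) (laguerre (n - 1))"
proof (rule poly_eqI)
  fix k
  have lag: "coeff (laguerre m) k = (- 1) ^ k * real (m choose k) / fact k" for m k
    by (simp add: coeff_laguerre binomial_eq_0)
  show "coeff ([:0, 1:] * laguerre n) k = coeff (smult (2 * real n + 1) (laguerre n)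
     - smult (real n + 1) (laguerre (Suc n)) - smult (real n) (laguerre (n - 1))) k"
  proof (cases k)
    case 0
    then show ?thesis by (simp add: lag)
  next
    case (Suc j)
    define a b where "a = real (n choose j)" and "b = real (n choose Suc j)"
    have b: "real (Suc j) * b = (real n - real j) * a"
    proof (cases "j \<le> n")
      case True
      have "Suc j * (n choose Suc j) = (n - j) * (n choose j)"
        by (metis binomial_absorb_comp binomial_absorption)
      then show ?thesis
        unfolding a_def b_def by (metis True of_nat_diff of_nat_mult)
    qed (simp add: a_def b_def binomial_eq_0)
    have pred: "real n * real ((n - 1) choose Suc j) = (real n - real (Suc j)) * b"
    proof (cases "Suc j \<le> n")
      case True
      have "n * ((n - 1) choose Suc j) = (n - Suc j) * (n choose Suc j)"
        by (metis binomial_absorb_comp)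
      then show ?thesis
        unfolding b_def by (metis True of_nat_diff of_nat_mult)
    qed (simp add: b_def binomial_eq_0)
    have succ: "real (Suc n choose Suc j) = a + b"
      by (simp add: a_def b_def)
    \<comment> \<open>With all binomials expressed by \<open>a\<close> and \<open>b\<close>, the
      right side is (j+1)b - (n+1)a, and the relation \<open>b\<close> finishes.\<close>
    have "- (real (Suc j) * a) = (2 * real n + 1) * b - (real n + 1) * real (Suc n choose Suc j)
        - real n * real ((n - 1) choose Suc j)"
      unfolding pred succ using b by (simp add: algebra_simps)
    then have "(- 1) ^ Suc j / fact (Suc j) * (- (real (Suc j) * a))
        = (- 1) ^ Suc j / fact (Suc j) * ((2 * real n + 1) * b - (real n + 1) * real (Suc n choose Suc j)
        - real n * real ((n - 1) choose Suc j))"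
      by simp
    also have "(- 1) ^ Suc j / fact (Suc j) * (- (real (Suc j) * a)) = (- 1) ^ j * a / fact j"
      by (simp add: fact_Suc del: of_nat_Suc)
    finally show ?thesis
      unfolding Suc by (simp add: lag a_def b_def algebra_simps diff_divide_distrib add_divide_distrib
        del: fact_Suc binomial_Suc_Suc)
  qed
qed

section \<open>Asymptotics of the moments\<close>

text \<open>These are the Fourier coefficients of the p-th power of the Toeplitz symbol;
  \<open>j = 0\<close> gives the arcsine moments. An integer \<open>j\<close> allows shifts in both
  directions.\<close>

definition arcsine_coeff :: "nat \<Rightarrow> int \<Rightarrow> real" where
  "arcsine_coeff p j = integral {0..pi} (\<lambda>t. (2 - 2 * cos t) ^ p * cos (of_int j * t)) / pi"

lemma arcsine_coeff_0: "arcsine_coeff 0 j = (if j = 0 then 1 else 0)"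
proof (cases "j = 0")
  case False
  have "((\<lambda>t. cos (of_int j * t)) has_integral
      (sin (of_int j * pi) / of_int j - sin (of_int j * 0) / of_int j)) {0..pi}"
    using False by (intro fundamental_theorem_of_calculus)
      (auto intro!: derivative_eq_intros simp flip: has_real_derivative_iff_has_vector_derivative)
  moreover have "sin (of_int j * pi) = 0"
    by (simp add: sin_zero_iff_int2)
  ultimately have "integral {0..pi} (\<lambda>t. cos (of_int j * t)) = 0"
    by (simp add: integral_unique)
  with False show ?thesis by (simp add: arcsine_coeff_def)
qed (simp add: arcsine_coeff_def)

text \<open>The identity 2 cos t cos(jt) = cos((j+1)t) + cos((j-1)t) yields the limiting form of the
  Laguerre recurrence.\<close>

lemma arcsine_coeff_Suc:
  "arcsine_coeff (Suc p) j = 2 * arcsine_coeff p j - arcsine_coeff p (j + 1) - arcsine_coeff p (j - 1)"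
proof -
  let ?f = "\<lambda>j t. (2 - 2 * cos t) ^ p * cos (of_int j * t)"
  have int: "?f j integrable_on {0..pi}" for j
    by (intro integrable_continuous_interval continuous_intros)
  have "integral {0..pi} (\<lambda>t. (2 - 2 * cos t) ^ Suc p * cos (of_int j * t))
      = integral {0..pi} (\<lambda>t. 2 * ?f j t - ?f (j + 1) t - ?f (j - 1) t)"
  proof (rule integral_cong)
    fix t :: real
    have cos_sum: "cos (of_int (j + 1) * t) + cos (of_int (j - 1) * t) = 2 * cos t * cos (of_int j * t)"
      by (simp add: cos_add cos_diff algebra_simps)
    have "2 * ?f j t - ?f (j + 1) t - ?f (j - 1) t
        = 2 * ?f j t - (2 - 2 * cos t) ^ p * (cos (of_int (j + 1) * t) + cos (of_int (j - 1) * t))"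
      by (simp only: distrib_left diff_diff_eq)
    also have "\<dots> = (2 - 2 * cos t) ^ Suc p * cos (of_int j * t)"
      unfolding cos_sum by (simp add: algebra_simps)
    finally show "(2 - 2 * cos t) ^ Suc p * cos (of_int j * t) = 2 * ?f j t - ?f (j + 1) t - ?f (j - 1) t"
      by simp
  qed
  also have "\<dots> = 2 * integral {0..pi} (?f j) - integral {0..pi} (?f (j + 1)) - integral {0..pi} (?f (j - 1))"
    by (intro integral_unique has_integral_diff has_integral_mult_right integrable_integral int)
  finally show ?thesis
    by (simp add: arcsine_coeff_def diff_divide_distrib)
qed

text \<open>Only \<open>j = 0\<close> concerns the moments, but each multiplication by x shifts the
  index, so the induction covers all offsets. Orthonormality is the base case. In the step, the
  recurrence coefficients divided by n tend to 2, 1 and 1, matching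
  \<open>arcsine_coeff_Suc\<close>.\<close>

lemma tendsto_laguerre_moment:
  "(\<lambda>n. laguerre_functional ([:0, 1:] ^ p * (laguerre n * laguerre (nat (int n + j)))) / real n ^ p)
     \<longlonglongrightarrow> arcsine_coeff p j"
proof (induction p arbitrary: j)
  case 0
  have "\<forall>\<^sub>F n in sequentially. arcsine_coeff 0 j = laguerre_functional (laguerre n * laguerre (nat (int n + j)))"
    using eventually_ge_at_top [of "nat \<bar>j\<bar>"]
    by eventually_elim
      (auto simp: normalized_laguerre_orthonormal [OF normalized_laguerre_laguerre] arcsine_coeff_0)
  then show ?case
    by (simp add: tendsto_eventually eq_commute)
next
  case (Suc p)
  let ?E = "\<lambda>j n. laguerre_functional ([:0, 1:] ^ p * (laguerre n * laguerre (nat (int n + j)))) / real n ^ p"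
  let ?a = "\<lambda>n. real n + of_int j"
  have coeffs: "(\<lambda>n. (2 * ?a n + 1) / real n) \<longlonglongrightarrow> 2" "(\<lambda>n. (?a n + 1) / real n) \<longlonglongrightarrow> 1"
      "(\<lambda>n. ?a n / real n) \<longlonglongrightarrow> 1"
    by real_asymp+
  have "(\<lambda>n. (2 * ?a n + 1) / real n * ?E j n - (?a n + 1) / real n * ?E (j + 1) n
      - ?a n / real n * ?E (j - 1) n)
      \<longlonglongrightarrow> 2 * arcsine_coeff p j - 1 * arcsine_coeff p (j + 1) - 1 * arcsine_coeff p (j - 1)"
    by (intro tendsto_intros coeffs Suc.IH)
  moreover have "\<forall>\<^sub>F n in sequentially. (2 * ?a n + 1) / real n * ?E j n
      - (?a n + 1) / real n * ?E (j + 1) n - ?a n / real n * ?E (j - 1) n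
      = laguerre_functional ([:0, 1:] ^ Suc p * (laguerre n * laguerre (nat (int n + j)))) / real n ^ Suc p"
    \<comment> \<open>This threshold ensures n + j \<ge> 1, so neither \<open>nat\<close> nor the
      index \<open>m - 1\<close> truncates.\<close>
    using eventually_ge_at_top [of "Suc (nat \<bar>j\<bar>)"]
  proof eventually_elim
    case (elim n)
    define m where "m = nat (int n + j)"
    have m: "nat (int n + (j + 1)) = Suc m" "nat (int n + (j - 1)) = m - 1" "?a n = real m"
      using elim by (auto simp: m_def)
    have "[:0, 1:] ^ Suc p * (laguerre n * laguerre m) = [:0, 1:] ^ p * (laguerre n * ([:0, 1:] * laguerre m))"
      by (simp only: power_Suc mult_ac)
    also have "\<dots> = smult (2 * real m + 1) ([:0, 1:] ^ p * (laguerre n * laguerre m))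
        - smult (real m + 1) ([:0, 1:] ^ p * (laguerre n * laguerre (Suc m)))
        - smult (real m) ([:0, 1:] ^ p * (laguerre n * laguerre (m - 1)))"
      by (simp only: laguerre_recurrence right_diff_distrib mult_smult_right)
    finally have "laguerre_functional ([:0, 1:] ^ Suc p * (laguerre n * laguerre m))
        = (2 * real m + 1) * laguerre_functional ([:0, 1:] ^ p * (laguerre n * laguerre m))
        - (real m + 1) * laguerre_functional ([:0, 1:] ^ p * (laguerre n * laguerre (Suc m)))
        - real m * laguerre_functional ([:0, 1:] ^ p * (laguerre n * laguerre (m - 1)))"
      by (simp only: laguerre_functional_diff laguerre_functional_smult)
    then show ?case
      unfolding m m_def [symmetric] by (simp add: diff_divide_distrib mult_ac)
  qed
  ultimately show ?case
    by (simp add: arcsine_coeff_Suc tendsto_cong)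
qed

section \<open>Moments of the rescaled Laguerre measures and of the arcsine law\<close>

lemma has_bochner_integral_laguerre_measure_power:
  assumes L: "normalized_laguerre L" and "n \<ge> 1"
  shows "has_bochner_integral (laguerre_measure L n) (\<lambda>x. x ^ p)
     (laguerre_functional ([:0, 1:] ^ p * (laguerre n * laguerre n)) / real n ^ p)"
  unfolding laguerre_measure_def
proof (rule has_bochner_integral_density)
  define q where "q = [:0, 1:] ^ p * (L n * L n)"
  have "has_bochner_integral lborel
      (\<lambda>x. indicator {0<..} (0 + real n * x) *\<^sub>R (poly q (0 + real n * x) * exp (- (0 + real n * x))))
      (laguerre_functional q /\<^sub>R \<bar>real n\<bar>)"
    using assms has_bochner_integral_poly_exp [of q]
    by (subst (asm) lborel_has_bochner_integral_real_affine_iff [where c = "real n" and t = 0]) auto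
  \<comment> \<open>The numerator is the factor n of the density; the denominator turns (nx)^p into
    x^p.\<close>
  then have "has_bochner_integral lborel
      (\<lambda>x. real n / real n ^ p * (indicator {0<..} (0 + real n * x) *\<^sub>R
        (poly q (0 + real n * x) * exp (- (0 + real n * x)))))
      (real n / real n ^ p * (laguerre_functional q /\<^sub>R \<bar>real n\<bar>))"
    by (rule has_bochner_integral_mult_right)
  also have "(\<lambda>x. real n / real n ^ p * (indicator {0<..} (0 + real n * x) *\<^sub>R
        (poly q (0 + real n * x) * exp (- (0 + real n * x)))))
      = (\<lambda>x. (indicator {0<..} x * (\<bar>poly (L n) (real n * x)\<bar>\<^sup>2 * (real n * exp (- (real n * x))))) *\<^sub>R x ^ p)"
    using assms by (auto simp: fun_eq_iff q_def indicator_def power_mult_distrib power2_eq_square zero_less_mult_iff)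
  also have "real n / real n ^ p * (laguerre_functional q /\<^sub>R \<bar>real n\<bar>) = laguerre_functional q / real n ^ p"
    using assms by (simp add: field_simps)
  also have "q = [:0, 1:] ^ p * (laguerre n * laguerre n)"
    unfolding q_def normalized_laguerre_square_unique [OF L normalized_laguerre_laguerre] ..
  finally show "has_bochner_integral lborel
      (\<lambda>x. (indicator {0<..} x * (\<bar>poly (L n) (real n * x)\<bar>\<^sup>2 * (real n * exp (- (real n * x))))) *\<^sub>R x ^ p)
      (laguerre_functional ([:0, 1:] ^ p * (laguerre n * laguerre n)) / real n ^ p)" .
  have "poly (L n) \<in> borel_measurable borel"
    by (intro borel_measurable_continuous_onI continuous_intros)
  then show "(\<lambda>x. indicator {0<..} x * (\<bar>poly (L n) (real n * x)\<bar>\<^sup>2 * (real n * exp (- (real n * x)))))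
      \<in> borel_measurable lborel"
    by measurable
qed (auto simp: indicator_def)

text \<open>Under x = 2 - 2 cos t the square root becomes 2 sin t and cancels against dx = 2 sin t
  dt. Since the integrand is nonnegative, a nonnegative integral yields both integrability and
  value.\<close>

lemma has_bochner_integral_arcsine_measure_power:
  "has_bochner_integral arcsine_measure (\<lambda>x. x ^ p) (arcsine_coeff p 0)"
  unfolding arcsine_measure_def
proof (rule has_bochner_integral_density)
  let ?w = "\<lambda>x. 1 / pi * (1 / sqrt (4 - (x - 2)\<^sup>2))"
  let ?g = "\<lambda>t::real. 2 - 2 * cos t"
  have w_nonneg: "0 \<le> ?w x" if "x \<in> {0<..<4}" for x
  proof -
    have "4 - (x - 2)\<^sup>2 = x * (4 - x)"
      by (simp add: power2_eq_square algebra_simps)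
    with that show ?thesis by simp
  qed
  show "has_bochner_integral lborel (\<lambda>x. (indicator {0<..<4} x * ?w x) *\<^sub>R x ^ p) (arcsine_coeff p 0)"
  proof (rule has_bochner_integral_nn_integral)
    have "(\<integral>\<^sup>+ x. ennreal ((indicator {0<..<4} x * ?w x) *\<^sub>R x ^ p) \<partial>lborel)
        = (\<integral>\<^sup>+ x. ennreal (?w x * x ^ p * indicator {?g 0..?g pi} x) \<partial>lborel)"
    proof (intro nn_integral_cong)
      fix x :: real
      consider "x = 0" | "x = 4" | "0 < x" "x < 4" | "x < 0 \<or> 4 < x" by linarith
      \<comment> \<open>at the two endpoints the weight vanishes, because division by 0 gives 0\<close>
      then show "ennreal ((indicator {0<..<4} x * ?w x) *\<^sub>R x ^ p)
          = ennreal (?w x * x ^ p * indicator {?g 0..?g pi} x)"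
        by cases auto
    qed
    also have "\<dots> = (\<integral>\<^sup>+ t. ennreal (?w (?g t) * ?g t ^ p * (2 * sin t) * indicator {0..pi} t) \<partial>lborel)"
      by (intro nn_integral_substitution [where g = ?g])
        (auto intro!: derivative_eq_intros continuous_intros sin_ge_zero simp: set_borel_measurable_def)
    also have "\<dots> = (\<integral>\<^sup>+ t. ennreal (?g t ^ p / pi) * indicator {0..pi} t \<partial>lborel)"
    \<comment> \<open>At t = 0 and t = pi the sine vanishes and cannot be cancelled, so equality is
      claimed only off this null set.\<close>
    proof (intro nn_integral_cong_AE AE_I [where N = "{0, pi}"])
      have "?w (?g t) * ?g t ^ p * (2 * sin t) = ?g t ^ p / pi" if "0 < t" "t < pi" for t
      proof -
        have "4 - (?g t - 2)\<^sup>2 = (2 * sin t)\<^sup>2"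
          by (simp add: power_mult_distrib sin_squared_eq)
        moreover have "sin t > 0"
          using that by (rule sin_gt_zero)
        ultimately have "sqrt (4 - (?g t - 2)\<^sup>2) = 2 * sin t"
          by (simp only: real_sqrt_abs)
        with \<open>sin t > 0\<close> show ?thesis by (simp only:) (simp add: divide_simps)
      qed
      then have "ennreal (?w (?g t) * ?g t ^ p * (2 * sin t) * indicator {0..pi} t)
          = ennreal (?g t ^ p / pi) * indicator {0..pi} t" if "t \<notin> {0, pi}" for t
        using that by (cases "0 < t \<and> t < pi") auto
      then show "{t \<in> space lborel. \<not> ennreal (?w (?g t) * ?g t ^ p * (2 * sin t) * indicator {0..pi} t)
          = ennreal (?g t ^ p / pi) * indicator {0..pi} t} \<subseteq> {0, pi}"
        by blast
    qed (auto simp: emeasure_lborel_countable)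
    also have "\<dots> = ennreal (arcsine_coeff p 0)"
    proof (rule nn_integral_has_integral_lebesgue')
      have "(\<lambda>t. ?g t ^ p) integrable_on {0..pi}"
        by (intro integrable_continuous_interval continuous_intros)
      then show "((\<lambda>t. ?g t ^ p / pi) has_integral arcsine_coeff p 0) {0..pi}"
        unfolding arcsine_coeff_def by (auto intro: has_integral_divide integrable_integral)
    qed (simp add: mult_left_le)
    finally show "(\<integral>\<^sup>+ x. ennreal ((indicator {0<..<4} x * ?w x) *\<^sub>R x ^ p) \<partial>lborel)
        = ennreal (arcsine_coeff p 0)" .
    have "?g t ^ p \<ge> 0" for t
      by simp
    then have "integral {0..pi} (\<lambda>t. ?g t ^ p) \<ge> 0"
      by (intro integral_nonneg integrable_continuous_interval continuous_intros)
    then show "0 \<le> arcsine_coeff p 0"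
      by (simp add: arcsine_coeff_def)
    show "AE x in lborel. 0 \<le> (indicator {0<..<4} x * ?w x) *\<^sub>R x ^ p"
      using w_nonneg by (auto simp: indicator_def)
  qed auto
  show "AE x in lborel. 0 \<le> indicator {0<..<4} x * ?w x"
    using w_nonneg by (auto simp: indicator_def)
qed auto

text \<open>The symbol is at most 4. This geometric bound on the moments is what the method of
  moments requires of the limit law.\<close>

lemma arcsine_coeff_le: "arcsine_coeff p 0 \<le> 4 ^ p"
proof -
  have "integral {0..pi} (\<lambda>t. (2 - 2 * cos t) ^ p) \<le> integral {0..pi} (\<lambda>t. 4 ^ p)"
  proof (intro integral_le integrable_continuous_interval continuous_intros power_mono)
    show "2 - 2 * cos t \<le> 4" for t :: real
      using cos_ge_minus_one [of t] by linarith
  qed simp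
  then show ?thesis
    by (simp add: arcsine_coeff_def field_simps)
qed

section \<open>The method of moments\<close>

lemma prob_spaceI_integral_one:
  assumes "has_bochner_integral M (\<lambda>_. 1 :: real) 1"
  shows "prob_space M"
proof (rule prob_spaceI)
  have "(\<integral>\<^sup>+ x. ennreal 1 \<partial>M) = ennreal 1"
    using assms by (subst nn_integral_eq_integral) (auto simp: has_bochner_integral_iff)
  then show "emeasure M (space M) = 1" by simp
qed

text \<open>
  The even Taylor polynomials of the characteristic functions are determined by the moments, and
  their remainders are controlled by even moments, uniformly in the limit.
\<close>

lemma weak_conv_m_moments:
  assumes M: "\<And>n. real_distribution (M n)" and M': "real_distribution M'"
    and int: "\<And>n k. integrable (M n) (\<lambda>x. x ^ k)" and int': "\<And>k. integrable M' (\<lambda>x. x ^ k)"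
    and lim: "\<And>k. (\<lambda>n. \<integral>x. x ^ k \<partial>M n) \<longlonglongrightarrow> (\<integral>x. x ^ k \<partial>M')"
    and bound: "\<And>k. (\<integral>x. x ^ k \<partial>M') \<le> C ^ k"
  shows "weak_conv_m M M'"
proof (rule levy_continuity [OF M M'])
  fix t
  define T where "T = (\<lambda>N \<mu>. \<Sum>k\<le>N. ((\<i> * complex_of_real t) ^ k / fact k) * complex_of_real (\<integral>x. x ^ k \<partial>\<mu>))"
  define R where "R = (\<lambda>N \<mu>. 2 * \<bar>t\<bar> ^ N / fact N * (\<integral>x. x ^ N \<partial>\<mu>))"
  \<comment> \<open>For even \<open>N\<close> the absolute moment in the Taylor remainder is an
    ordinary moment, whose limit is known.\<close>
  have approx: "cmod (char \<mu> t - T N \<mu>) \<le> R N \<mu>"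
    if "real_distribution \<mu>" "\<And>k. integrable \<mu> (\<lambda>x. x ^ k)" "even N" for \<mu> N
    using real_distribution.char_approx1 [of \<mu> N t] that by (simp add: T_def R_def power_even_abs)
  show "(\<lambda>n. char (M n) t) \<longlonglongrightarrow> char M' t"
  proof (rule tendstoI)
    fix e :: real
    assume "e > 0"
    \<comment> \<open>Up to the factor 2, these are the terms of the exponential series at
      |t|C.\<close>
    have "(\<lambda>N. 2 * (inverse (fact N) * (\<bar>t\<bar> * C) ^ N)) \<longlonglongrightarrow> 2 * 0"
      by (intro tendsto_intros summable_LIMSEQ_zero summable_exp)
    then have "\<forall>\<^sub>F N in sequentially. 2 * (inverse (fact N) * (\<bar>t\<bar> * C) ^ N) < e / 3"
      by (rule order_tendstoD) (use \<open>e > 0\<close> in simp)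
    then obtain N0 where N0: "\<And>N. N \<ge> N0 \<Longrightarrow> 2 * (inverse (fact N) * (\<bar>t\<bar> * C) ^ N) < e / 3"
      by (auto simp: eventually_sequentially)
    \<comment> \<open>Doubling makes \<open>N\<close> even while keeping it at least
      \<open>N0\<close>.\<close>
    define N where "N = 2 * N0"
    have "R N M' \<le> 2 * \<bar>t\<bar> ^ N / fact N * C ^ N"
      unfolding R_def by (intro mult_left_mono bound) auto
    also have "\<dots> = 2 * (inverse (fact N) * (\<bar>t\<bar> * C) ^ N)"
      by (simp add: power_mult_distrib field_simps)
    also have "\<dots> < e / 3"
      by (intro N0) (simp add: N_def)
    finally have R': "R N M' < e / 3" .
    have "(\<lambda>n. R N (M n)) \<longlonglongrightarrow> R N M'"
      unfolding R_def by (intro tendsto_intros lim)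
    \<comment> \<open>With \<open>N\<close> fixed, the strict bound on the limit passes to the
      remainders of \<open>M n\<close> for all large n.\<close>
    then have "\<forall>\<^sub>F n in sequentially. R N (M n) < e / 3"
      using R' by (rule order_tendstoD)
    moreover have "(\<lambda>n. T N (M n)) \<longlonglongrightarrow> T N M'"
      unfolding T_def by (intro tendsto_intros lim)
    then have "\<forall>\<^sub>F n in sequentially. dist (T N (M n)) (T N M') < e / 3"
      using \<open>e > 0\<close> by (intro tendstoD) auto
    ultimately show "\<forall>\<^sub>F n in sequentially. dist (char (M n) t) (char M' t) < e"
    proof eventually_elim
      case (elim n)
      have "dist (char (M n) t) (T N (M n)) < e / 3"
        using approx [OF M int, of N n] elim by (simp add: dist_norm N_def)
      moreover have "dist (char M' t) (T N M') < e / 3"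
        using approx [OF M' int', of N] R' by (simp add: dist_norm N_def)
      ultimately show ?case
        using elim by metric
    qed
  qed
qed

theorem theorem5p3:
  fixes L :: "nat \<Rightarrow> real poly"
  assumes "normalized_laguerre L"
  shows "(\<forall>n\<ge>1. prob_space (laguerre_measure L n)) \<and>
         prob_space arcsine_measure \<and>
         weak_conv_m (laguerre_measure L) arcsine_measure"
proof (intro conjI allI impI)
  note moment = has_bochner_integral_laguerre_measure_power [OF assms]
  note moment' = has_bochner_integral_arcsine_measure_power
  show prob: "prob_space (laguerre_measure L n)" if "n \<ge> 1" for n
    using moment [OF that, of 0]
    by (intro prob_spaceI_integral_one)
      (simp add: normalized_laguerre_orthonormal [OF normalized_laguerre_laguerre])
  show prob': "prob_space arcsine_measure"
    using moment' [of 0] by (intro prob_spaceI_integral_one) (simp add: arcsine_coeff_0)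
  \<comment> \<open>The index is shifted because the density vanishes for \<open>n = 0\<close>, so
    that measure is not a probability measure; the shift does not affect the limit.\<close>
  have "weak_conv_m (\<lambda>n. laguerre_measure L (Suc n)) arcsine_measure"
  proof (rule weak_conv_m_moments)
    show "real_distribution (laguerre_measure L (Suc n))" for n
      using prob [of "Suc n"]
      by (simp add: real_distribution_def real_distribution_axioms_def laguerre_measure_def)
    show "real_distribution arcsine_measure"
      using prob' by (simp add: real_distribution_def real_distribution_axioms_def arcsine_measure_def)
    show "integrable (laguerre_measure L (Suc n)) (\<lambda>x. x ^ k)" for n k
      using moment [of "Suc n" k] by (simp add: has_bochner_integral_iff)
    show "integrable arcsine_measure (\<lambda>x. x ^ k)" for k
      using moment' [of k] by (simp add: has_bochner_integral_iff)
    show "(\<integral>x. x ^ k \<partial>arcsine_measure) \<le> 4 ^ k" for k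
      using moment' [of k] arcsine_coeff_le [of k] by (simp add: has_bochner_integral_iff)
    have "(\<integral>x. x ^ k \<partial>laguerre_measure L (Suc n))
        = laguerre_functional ([:0, 1:] ^ k * (laguerre (Suc n) * laguerre (Suc n))) / real (Suc n) ^ k" for n k
      using moment [of "Suc n" k] by (simp add: has_bochner_integral_iff)
    moreover have "(\<integral>x. x ^ k \<partial>arcsine_measure) = arcsine_coeff k 0" for k
      using moment' [of k] by (simp add: has_bochner_integral_iff)
    ultimately show "(\<lambda>n. \<integral>x. x ^ k \<partial>laguerre_measure L (Suc n)) \<longlonglongrightarrow> (\<integral>x. x ^ k \<partial>arcsine_measure)" for k
      using LIMSEQ_Suc [OF tendsto_laguerre_moment [of k 0]] by (simp del: of_nat_Suc)
  qed
  then show "weak_conv_m (laguerre_measure L) arcsine_measure"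
    unfolding weak_conv_m_def weak_conv_def by (auto intro: LIMSEQ_imp_Suc)
qed

end
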